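(* Consider the forest fire model on $\mathbb{Z}_+$ with instant spread ($\Delta\equiv0$) and constant burning time $\theta>0$. There exists an $\alpha>0$ such that almost surely $m_i\ge\exp(\exp(\alpha i))$ for all large $i$.
   Context: Forest fire model with instant spread and constant burning time $\theta>0$ on $\mathbb{Z}_+=\{0,1,2,\dots\}$. Each site is vacant, occupied by a non-burning tree, or occupied by a burning tree; all sites are vacant at time $0$. At each vacant site a tree appears after an $\exp(1)$ time, independently of everything else. There is a constant source of fire at site $0$: a tree appearing at $0$ starts burning immediately. A tree that starts burning burns for a time $\theta$, after which its site becomes vacant. Let $f_{x,i}$ be the time when site $x$ starts burning for the $i$-th time. Spread: if at time $t=f_{x,i}$ there is a non-burning tree at $x+1$, it starts burning at time $t$. Otherwise, if the next tree at $x+1$ appears at time $t+\nu$, $\nu>0$, it starts burning immediately at time $t+\nu$ if $\nu<\theta$, while if $\nu\ge\theta$ this fire does not propagate beyond $x$. While a site is burning, no tree grows there and no fire can spread to it from the left. The $k$-th fire is the one started by the $k$-th burning of site $0$, together with all burnings successively ignited by it. Successive maxima: $m_1$ is the location of the farthest tree from the origin burnt by the first fire, and for $k\ge2$, $m_k$ is the location of the farthest tree from the origin burnt by the first fire which reaches beyond $m_{k-1}$ (with $m_k=\infty$ if that fire never stops or $m_{k-1}=\infty$; in this model all $m_k$ are a.s. finite). *)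

theory Defs
  imports "HOL-Probability.Probability"
begin

text \<open>
  A realisation of the forest fire model is a function of the waiting times \<open>E x i\<close>: the time that
  site \<open>x\<close> stays vacant before its tree number \<open>i\<close> appears. Burnings of a site, trees and fires are
  counted from \<open>0\<close>, so \<open>burn_time \<theta> E x i\<close> is the time usually written \<open>f\<^sub>x\<^sub>,\<^sub>i\<^sub>+\<^sub>1\<close>.
  Every tree of a site is burnt before the next one can grow there, so tree \<open>i\<close> is the one that is
  consumed in burning \<open>i\<close>.

  The random model is obtained by letting all \<open>E x i\<close> be independent and exponentially distributed
  with parameter \<open>1\<close>. The waiting times are then almost surely positive, and at every site the
  burning times are more than \<open>\<theta>\<close> apart and tend to infinity.
\<close>

text \<open>
  If the left neighbour of a site starts burning at the times \<open>g 0 < g 1 < \<dots>\<close>, a tree appearing at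
  the site at time \<open>T\<close> starts burning at time \<open>ignition_time \<theta> g T\<close>: immediately, if the neighbour
  is burning at time \<open>T\<close> (that is, \<open>T = g i + \<nu>\<close> with \<open>0 \<le> \<nu> < \<theta>\<close>), and otherwise at the next time at
  which the neighbour starts burning.
\<close>

definition ignition_time :: "real \<Rightarrow> (nat \<Rightarrow> real) \<Rightarrow> real \<Rightarrow> real" where
  "ignition_time \<theta> g T =
     (if \<exists>i. g i \<le> T \<and> T < g i + \<theta> then T else g (LEAST i. T \<le> g i))"

text \<open>
  The burning times of one site with waiting times \<open>e\<close>, where \<open>c\<close> maps the time at which a tree
  appears to the time at which this tree starts burning. The site is vacant at time \<open>0\<close>, and again
  when a burning ends.
\<close>

primrec site_burn_times :: "(real \<Rightarrow> real) \<Rightarrow> real \<Rightarrow> (nat \<Rightarrow> real) \<Rightarrow> nat \<Rightarrow> real" where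
  "site_burn_times c \<theta> e 0 = c (e 0)"
| "site_burn_times c \<theta> e (Suc i) = c (site_burn_times c \<theta> e i + \<theta> + e (Suc i))"

text \<open>At site \<open>0\<close>, the constant source of fire, a tree starts burning as soon as it appears.\<close>

primrec burn_time :: "real \<Rightarrow> (nat \<Rightarrow> nat \<Rightarrow> real) \<Rightarrow> nat \<Rightarrow> nat \<Rightarrow> real" where
  "burn_time \<theta> E 0 = site_burn_times (\<lambda>T. T) \<theta> (E 0)"
| "burn_time \<theta> E (Suc x) =
     site_burn_times (ignition_time \<theta> (burn_time \<theta> E x)) \<theta> (E (Suc x))"

text \<open>
  The burnings \<open>(x, i)\<close> (site, number) belonging to fire \<open>k\<close>. Since the burning periods of \<open>x\<close> are
  disjoint and \<open>Suc x\<close> only catches fire from \<open>x\<close> while \<open>x\<close> is burning, the burning of \<open>Suc x\<close>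
  ignited by burning \<open>i\<close> of \<open>x\<close> is the one, if any, that starts during this burning of \<open>x\<close>.
\<close>

inductive_set fire :: "real \<Rightarrow> (nat \<Rightarrow> nat \<Rightarrow> real) \<Rightarrow> nat \<Rightarrow> (nat \<times> nat) set"
  for \<theta> :: real and E :: "nat \<Rightarrow> nat \<Rightarrow> real" and k :: nat
where
  source: "(0, k) \<in> fire \<theta> E k"
| spread: "(x, i) \<in> fire \<theta> E k \<Longrightarrow> burn_time \<theta> E x i \<le> burn_time \<theta> E (Suc x) j \<Longrightarrow>
     burn_time \<theta> E (Suc x) j < burn_time \<theta> E x i + \<theta> \<Longrightarrow> (Suc x, j) \<in> fire \<theta> E k"

definition fire_reach :: "real \<Rightarrow> (nat \<Rightarrow> nat \<Rightarrow> real) \<Rightarrow> nat \<Rightarrow> enat" where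
  "fire_reach \<theta> E k = (SUP (x, i)\<in>fire \<theta> E k. enat x)"

text \<open>
  The successive maxima \<open>m\<^sub>1, m\<^sub>2, \<dots>\<close>; index \<open>0\<close> is not used. The last alternative, in which no fire
  reaches beyond the preceding maximum, is an arbitrary convention.
\<close>

fun succ_max :: "real \<Rightarrow> (nat \<Rightarrow> nat \<Rightarrow> real) \<Rightarrow> nat \<Rightarrow> enat" where
  "succ_max \<theta> E 0 = 0"
| "succ_max \<theta> E (Suc 0) = fire_reach \<theta> E 0"
| "succ_max \<theta> E (Suc (Suc n)) =
     (let m = succ_max \<theta> E (Suc n) in
      if m = \<infinity> then \<infinity>
      else if \<exists>k. m < fire_reach \<theta> E k then fire_reach \<theta> E (LEAST k. m < fire_reach \<theta> E k)
      else m)"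

end

theory Submission
  imports Defs "HOL-Real_Asymp.Real_Asymp"
begin

text \<open>
  Let \<open>\<tau>\<^sub>x\<close> be the time of the first burning of \<open>x\<close>. The successive maxima are the sites \<open>y\<close> whose right
  neighbour grows its first tree no earlier than \<open>\<tau>\<^sub>y + \<theta>\<close>; call them breaks. The fire that
  first passes a break \<open>y\<close> burns every \<open>z \<le> y\<close> at least for the second time, so
  \<open>\<tau>\<^sub>y\<^sub>+\<^sub>1 \<ge> \<tau>\<^sub>z + \<theta> + E z 1\<close> at a break \<open>y\<close>; in particular \<open>\<tau>\<close> exceeds \<open>j \<theta>\<close> after \<open>j\<close> breaks.

  Let \<open>x\<close> be the \<open>j\<close>-th break and \<open>s = \<tau>\<^sub>x\<^sub>+\<^sub>1\<close>. Given the sites up to \<open>x + 1\<close>, each further site is a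
  break with probability at most \<open>exp (- s)\<close>, so there is none among the next \<open>exp (s / 2)\<close> sites, up to
  probability \<open>exp (- s / 2)\<close>; and on that many sites the largest \<open>E z 1\<close> exceeds \<open>s / 4\<close>, up to
  probability \<open>exp (- s / 4)\<close>. As \<open>s \<ge> j \<theta>\<close>, Borel-Cantelli applies: eventually \<open>\<tau>\<close> grows by a constant
  factor from break to break, and the next break lies beyond \<open>exp (s / 4)\<close>. Rounding \<open>s\<close> down to an
  integer \<open>n\<close> reduces the conditioning to countably many products of independent events.
\<close>

section \<open>Breaks and their numbering\<close>

definition is_break :: "real \<Rightarrow> (nat \<Rightarrow> nat \<Rightarrow> real) \<Rightarrow> nat \<Rightarrow> bool" where
  "is_break \<theta> E y \<longleftrightarrow> burn_time \<theta> E y 0 + \<theta> \<le> E (Suc y) 0"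

text \<open>Breaks are numbered from \<open>0\<close>, so that
  \<open>succ_max \<theta> E (Suc n)\<close> is break number \<open>n\<close> unless it is infinite.
  Counting the breaks below avoids enumerating a set that may be finite.\<close>

definition nth_break :: "real \<Rightarrow> (nat \<Rightarrow> nat \<Rightarrow> real) \<Rightarrow> nat \<Rightarrow> nat \<Rightarrow> bool" where
  "nth_break \<theta> E j y \<longleftrightarrow> is_break \<theta> E y \<and> card {b. b < y \<and> is_break \<theta> E b} = j"

lemma nth_break_inj:
  assumes "nth_break \<theta> E j x" "nth_break \<theta> E j y"
  shows "x = y"
proof -
  have less: "\<not> x < y" if "nth_break \<theta> E j x" "nth_break \<theta> E j y" for x y
  proof
    assume "x < y"
    with that have "{b. b < x \<and> is_break \<theta> E b} \<subset> {b. b < y \<and> is_break \<theta> E b}"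
      by (auto simp: nth_break_def)
    then have "card {b. b < x \<and> is_break \<theta> E b} < card {b. b < y \<and> is_break \<theta> E b}"
      by (intro psubset_card_mono) auto
    with that show False by (simp add: nth_break_def)
  qed
  from less[OF assms] less[OF assms(2,1)] show ?thesis by simp
qed

section \<open>Ignition by a left neighbour\<close>

definition sparse_times :: "real \<Rightarrow> (nat \<Rightarrow> real) \<Rightarrow> bool" where
  "sparse_times \<theta> g \<longleftrightarrow> (\<forall>i. g i + \<theta> \<le> g (Suc i))"

lemma sparse_times_mult:
  assumes "sparse_times \<theta> g"
  shows "g i + real k * \<theta> \<le> g (i + k)"
proof (induction k)
  case (Suc k)
  have "g (i + k) + \<theta> \<le> g (i + Suc k)"
    using assms unfolding sparse_times_def by simp
  with Suc show ?case by (simp add: algebra_simps)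
qed simp

lemma sparse_times_less:
  assumes "sparse_times \<theta> g" "0 < \<theta>" "i < k"
  shows "g i + \<theta> \<le> g k"
proof -
  obtain d where "k = Suc (i + d)" using \<open>i < k\<close> less_imp_Suc_add by blast
  then have "g i + real d * \<theta> \<le> g (i + d)" "g (i + d) + \<theta> \<le> g k"
    using sparse_times_mult[OF assms(1)] assms(1) by (auto simp: sparse_times_def)
  moreover have "0 \<le> real d * \<theta>" using assms(2) by simp
  ultimately show ?thesis by linarith
qed

text \<open>A tree either appears during a burning of the neighbour or starts together with one; in
  the latter case 0 < \<theta> suffices, whatever index \<open>LEAST\<close> returns.\<close>

lemma ignition_time_cases:
  assumes "sparse_times \<theta> g" "0 < \<theta>"
  obtains i where "g i \<le> ignition_time \<theta> g T" "ignition_time \<theta> g T < g i + \<theta>"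
proof (cases "\<exists>i. g i \<le> T \<and> T < g i + \<theta>")
  case True
  then show ?thesis using that by (auto simp: ignition_time_def)
next
  case False
  then have "ignition_time \<theta> g T = g (LEAST i. T \<le> g i)" by (simp only: ignition_time_def if_False)
  then show ?thesis using that[of "LEAST i. T \<le> g i"] assms(2) by simp
qed

text \<open>Sparse times are unbounded, so some \<open>g i\<close> is at least \<open>T\<close> and
  \<open>LEAST\<close> is a genuine minimum.\<close>

lemma ignition_time_ge:
  assumes "sparse_times \<theta> g" "0 < \<theta>"
  shows "T \<le> ignition_time \<theta> g T"
proof (cases "\<exists>i. g i \<le> T \<and> T < g i + \<theta>")
  case False
  obtain k where "T - g 0 < real k * \<theta>" using assms(2) reals_Archimedean3 by blast
  then have "T \<le> g k" using sparse_times_mult[OF assms(1), of 0 k] by simp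
  then have "T \<le> g (LEAST i. T \<le> g i)" by (rule LeastI)
  then show ?thesis using False by (simp add: ignition_time_def)
qed (auto simp: ignition_time_def)

section \<open>Burning times of a fixed realisation\<close>

locale forest_fire =
  fixes \<theta> :: real and E :: "nat \<Rightarrow> nat \<Rightarrow> real"
  assumes burning_pos: "0 < \<theta>" and waiting_pos: "\<And>x i. 0 < E x i"
begin

abbreviation f where "f \<equiv> burn_time \<theta> E"

text \<open>The bounds at \<open>x\<close> make its burning times sparse, which
  \<open>ignition_time_ge\<close> requires at \<open>Suc x\<close>; hence the joint induction over
  sites.\<close>

lemma burn_time_ge:
  "E x 0 \<le> f x 0 \<and> (\<forall>i. f x i + \<theta> + E x (Suc i) \<le> f x (Suc i))"
proof (induction x)
  case (Suc x)
  have "sparse_times \<theta> (f x)"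
    unfolding sparse_times_def
  proof
    fix i show "f x i + \<theta> \<le> f x (Suc i)"
      using Suc waiting_pos[of x "Suc i"] by (smt (verit))
  qed
  then show ?case using ignition_time_ge[OF _ burning_pos, of "f x"] by simp
qed simp

lemma sparse_burn_time: "sparse_times \<theta> (f x)"
  unfolding sparse_times_def
proof
  fix i show "f x i + \<theta> \<le> f x (Suc i)"
    using burn_time_ge[of x] waiting_pos[of x "Suc i"] by (smt (verit))
qed

lemmas burn_time_less = sparse_times_less[OF sparse_burn_time burning_pos]

lemma ignited_by_left:
  obtains i where "f x i \<le> f (Suc x) j" "f (Suc x) j < f x i + \<theta>"
proof -
  have "\<exists>T. f (Suc x) j = ignition_time \<theta> (f x) T"
    by (cases j) auto
  then show ?thesis
    using ignition_time_cases[OF sparse_burn_time[of x] burning_pos] that by metis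
qed

text \<open>Each burning of \<open>Suc x\<close> starts during a burning of \<open>x\<close>. Two
  burnings of \<open>Suc x\<close> start at least \<theta> apart, so never during the same burning
  of \<open>x\<close>; hence burning \<open>j\<close> of \<open>Suc x\<close> starts during burning
  \<open>j\<close> of \<open>x\<close> or a later one.\<close>

lemma burn_time_mono_site: "f x j \<le> f (Suc x) j"
proof (induction j)
  case 0
  obtain i where "f x i \<le> f (Suc x) 0" using ignited_by_left by metis
  moreover have "f x 0 \<le> f x i"
    using burn_time_less[of 0 i x] burning_pos by (cases i) auto
  ultimately show ?case by simp
next
  case (Suc j)
  obtain i where i: "f x i \<le> f (Suc x) (Suc j)" "f (Suc x) (Suc j) < f x i + \<theta>"
    using ignited_by_left by metis
  have "f x j + \<theta> < f x i + \<theta>"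
    using Suc i(2) burn_time_less[of j "Suc j" "Suc x"] by simp
  then have "Suc j \<le> i"
    using burn_time_less[of i j x] burning_pos by (cases i j rule: linorder_cases) auto
  then have "f x (Suc j) \<le> f x i"
    using burn_time_less[of "Suc j" i x] burning_pos by (cases "Suc j = i") auto
  with i show ?case by simp
qed

lemma burn_time_mono: "x \<le> y \<Longrightarrow> f x j \<le> f y j"
  by (rule lift_Suc_mono_le[of "\<lambda>x. f x j"]) (rule burn_time_mono_site)

lemma burn_time_mono_index: "i \<le> j \<Longrightarrow> f x i \<le> f x j"
  using burn_time_less[of i j x] burning_pos by (cases "i = j") auto

lemma burn_time_pos: "0 < f x i"
  using burn_time_mono_index[of 0 i x] burn_time_ge[of x] waiting_pos[of x 0] by linarith

text \<open>The first tree of \<open>Suc y\<close> appears only when burning \<open>0\<close> of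
  \<open>y\<close> is over, so it is ignited by burning \<open>1\<close> of \<open>y\<close> or a
  later one, and burning \<open>1\<close> of \<open>y\<close> is no earlier than that of
  \<open>z\<close>. A single large \<open>E z 1\<close> behind the break thus delays everything
  beyond it.\<close>

lemma burn_time_after_break:
  assumes "is_break \<theta> E y" "z \<le> y"
  shows "f z 0 + \<theta> + E z 1 \<le> f (Suc y) 0"
proof -
  obtain i where i: "f y i \<le> f (Suc y) 0" "f (Suc y) 0 < f y i + \<theta>"
    using ignited_by_left by metis
  have "f y 0 + \<theta> \<le> f (Suc y) 0"
    using assms(1) burn_time_ge[of "Suc y"] by (simp add: is_break_def)
  then have "1 \<le> i" using i(2) by (cases i) auto
  then have "f y 1 \<le> f (Suc y) 0" using i(1) burn_time_mono_index[of 1 i y] by simp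
  moreover have "f z 0 + \<theta> + E z 1 \<le> f z 1" using burn_time_ge[of z] by simp
  ultimately show ?thesis using burn_time_mono[OF assms(2), of 1] by simp
qed

text \<open>The first tree of \<open>Suc y\<close> either appears during burning \<open>0\<close> of
  \<open>y\<close> or is already waiting when it starts.\<close>

lemma burn_time_not_break:
  assumes "\<not> is_break \<theta> E y"
  shows "f (Suc y) 0 < f y 0 + \<theta>"
proof (cases "f y 0 \<le> E (Suc y) 0")
  case True
  then have "\<exists>i. f y i \<le> E (Suc y) 0 \<and> E (Suc y) 0 < f y i + \<theta>"
    using assms by (auto simp: is_break_def not_le)
  then have "f (Suc y) 0 = E (Suc y) 0" by (auto simp: ignition_time_def)
  then show ?thesis using assms by (simp add: is_break_def)
next
  case False
  then have "\<nexists>i. f y i \<le> E (Suc y) 0 \<and> E (Suc y) 0 < f y i + \<theta>"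
    using burn_time_mono_index[of 0 _ y] by (meson le0 order_trans)
  moreover have "(LEAST i. E (Suc y) 0 \<le> f y i) = 0"
    using False by (intro Least_equality) auto
  ultimately have "f (Suc y) 0 = f y 0" by (simp only: burn_time.simps site_burn_times.simps ignition_time_def if_False)
  then show ?thesis using burning_pos by simp
qed

text \<open>By \<open>burn_time_after_break\<close> with \<open>z = y\<close>, every break costs at
  least \<theta>.\<close>

lemma card_breaks_below:
  "card {b. b < y \<and> is_break \<theta> E b} * \<theta> \<le> f y 0"
proof (induction y)
  case 0
  show ?case using burn_time_pos[of 0 0] by simp
next
  case (Suc y)
  show ?case
  proof (cases "is_break \<theta> E y")
    case True
    then have "{b. b < Suc y \<and> is_break \<theta> E b} = insert y {b. b < y \<and> is_break \<theta> E b}"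
      by (auto simp: less_Suc_eq)
    moreover have "f y 0 + \<theta> + E y 1 \<le> f (Suc y) 0" using burn_time_after_break[OF True] by blast
    ultimately show ?thesis using Suc waiting_pos[of y 1] by (simp add: algebra_simps)
  next
    case False
    then have "{b. b < Suc y \<and> is_break \<theta> E b} = {b. b < y \<and> is_break \<theta> E b}"
      by (auto simp: less_Suc_eq)
    then show ?thesis using Suc burn_time_mono_site[of y 0] by simp
  qed
qed

lemma nth_break_time:
  assumes "nth_break \<theta> E j y"
  shows "real j * \<theta> \<le> f (Suc y) 0"
  using assms card_breaks_below[of y] burn_time_mono_site[of y 0] by (auto simp: nth_break_def)

lemma nth_break_Suc:
  assumes "nth_break \<theta> E j x" "x < y" "is_break \<theta> E y"
    and "\<And>z. x < z \<Longrightarrow> z < y \<Longrightarrow> \<not> is_break \<theta> E z"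
  shows "nth_break \<theta> E (Suc j) y"
proof -
  have "{b. b < y \<and> is_break \<theta> E b} = insert x {b. b < x \<and> is_break \<theta> E b}"
  proof (intro equalityI subsetI)
    fix b assume b: "b \<in> {b. b < y \<and> is_break \<theta> E b}"
    then have "\<not> x < b" using assms(4) by blast
    with b show "b \<in> insert x {b. b < x \<and> is_break \<theta> E b}" by auto
  qed (use assms in \<open>auto simp: nth_break_def\<close>)
  then show ?thesis using assms by (simp add: nth_break_def)
qed

lemma nth_break_less:
  assumes "nth_break \<theta> E j x" "nth_break \<theta> E (Suc j) y"
  shows "x < y"
proof (rule ccontr)
  assume "\<not> x < y"
  then have "{b. b < y \<and> is_break \<theta> E b} \<subseteq> {b. b < x \<and> is_break \<theta> E b}" by auto
  then have "card {b. b < y \<and> is_break \<theta> E b} \<le> card {b. b < x \<and> is_break \<theta> E b}"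
    by (intro card_mono) auto
  with assms show False by (simp add: nth_break_def)
qed

section \<open>Fires and the successive maxima\<close>

lemma ex_fire: "\<exists>k. (x, i) \<in> fire \<theta> E k"
proof (induction x arbitrary: i)
  case 0
  show ?case using fire.source by blast
next
  case (Suc x)
  obtain a where a: "f x a \<le> f (Suc x) i" "f (Suc x) i < f x a + \<theta>"
    using ignited_by_left by metis
  obtain k where "(x, a) \<in> fire \<theta> E k" using Suc.IH by blast
  then have "(Suc x, i) \<in> fire \<theta> E k" using a by (rule fire.spread)
  then show ?case ..
qed

text \<open>Fires do not overtake each other: a reversed order at \<open>Suc x\<close> would put two
  of its burnings less than \<theta> apart. With \<open>k = k'\<close>, a fire burns each site at
  most once.\<close>

lemma fire_index_mono:
  "(x, i) \<in> fire \<theta> E k \<Longrightarrow> (x, i') \<in> fire \<theta> E k' \<Longrightarrow> k \<le> k' \<Longrightarrow> i \<le> i'"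
proof (induction x arbitrary: i i')
  case 0
  then show ?case by (auto elim: fire.cases)
next
  case (Suc x)
  from Suc.prems(1) obtain a where a: "(x, a) \<in> fire \<theta> E k" "f (Suc x) i < f x a + \<theta>"
    by (auto elim: fire.cases)
  from Suc.prems(2) obtain b where b: "(x, b) \<in> fire \<theta> E k'" "f x b \<le> f (Suc x) i'"
    by (auto elim: fire.cases)
  have "f x a \<le> f x b" using Suc.IH[OF a(1) b(1) Suc.prems(3)] by (rule burn_time_mono_index)
  with a(2) b(2) have "f (Suc x) i < f (Suc x) i' + \<theta>" by linarith
  then show ?case using burn_time_less[of i' i "Suc x"] by force
qed

lemma fire_downward:
  assumes "(y, i) \<in> fire \<theta> E k" "x \<le> y"
  shows "\<exists>j. (x, j) \<in> fire \<theta> E k"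
  using assms
proof (induction y arbitrary: i)
  case (Suc y)
  show ?case
  proof (cases "x = Suc y")
    case True
    then show ?thesis using Suc.prems by blast
  next
    case False
    moreover obtain a where "(y, a) \<in> fire \<theta> E k"
      using Suc.prems(1) by (auto elim: fire.cases)
    ultimately show ?thesis using Suc by simp
  qed
qed auto

lemma less_fire_reach_iff: "enat m < fire_reach \<theta> E k \<longleftrightarrow> (\<exists>i. (Suc m, i) \<in> fire \<theta> E k)"
proof
  assume "enat m < fire_reach \<theta> E k"
  then obtain y i where "(y, i) \<in> fire \<theta> E k" "m < y"
    by (auto simp: fire_reach_def less_SUP_iff)
  then show "\<exists>i. (Suc m, i) \<in> fire \<theta> E k" using fire_downward[of y i k "Suc m"] by simp
next
  assume "\<exists>i. (Suc m, i) \<in> fire \<theta> E k"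
  then show "enat m < fire_reach \<theta> E k"
    by (auto simp: fire_reach_def less_SUP_iff intro!: bexI)
qed

lemma fire_first_burning_run:
  assumes "(x, 0) \<in> fire \<theta> E k" "x \<le> y" "\<And>z. x \<le> z \<Longrightarrow> z < y \<Longrightarrow> \<not> is_break \<theta> E z"
  shows "(y, 0) \<in> fire \<theta> E k"
  using assms(2,3)
proof (induction y rule: dec_induct)
  case (step y)
  then have "(y, 0) \<in> fire \<theta> E k" by simp
  moreover have "f (Suc y) 0 < f y 0 + \<theta>" using step by (intro burn_time_not_break) auto
  ultimately show ?case using fire.spread burn_time_mono_site by blast
qed (use assms(1) in simp)

text \<open>By \<open>fire_index_mono\<close> the fire burns \<open>y\<close> only in burning
  \<open>0\<close>, and this is over before \<open>Suc y\<close> has its first tree.\<close>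

lemma fire_stops_at_break:
  assumes "(y, 0) \<in> fire \<theta> E k" "is_break \<theta> E y"
  shows "(Suc y, j) \<notin> fire \<theta> E k"
proof
  assume "(Suc y, j) \<in> fire \<theta> E k"
  then obtain a where a: "(y, a) \<in> fire \<theta> E k" "f (Suc y) j < f y a + \<theta>"
    by (auto elim: fire.cases)
  have "a \<le> 0" using fire_index_mono[OF a(1) assms(1)] by simp
  with a(2) have "f (Suc y) j < E (Suc y) 0" using assms(2) by (simp add: is_break_def)
  then show False using burn_time_ge[of "Suc y"] burn_time_mono_index[of 0 j "Suc y"] by simp
qed

text \<open>Such a fire consists of first burnings from \<open>x\<close> on and ends at the first
  break. If there is none, it never stops; that case is harmless for a lower bound on the
  maxima.\<close>

lemma fire_reach_eq_break:
  assumes "(x, 0) \<in> fire \<theta> E k"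
  shows "fire_reach \<theta> E k = \<infinity> \<or>
    (\<exists>y\<ge>x. is_break \<theta> E y \<and> (\<forall>z. x \<le> z \<longrightarrow> z < y \<longrightarrow> \<not> is_break \<theta> E z) \<and> fire_reach \<theta> E k = enat y)"
proof (cases "\<exists>y\<ge>x. is_break \<theta> E y")
  case True
  define y where "y = (LEAST y. x \<le> y \<and> is_break \<theta> E y)"
  have y: "x \<le> y" "is_break \<theta> E y" using LeastI_ex[OF True] by (auto simp: y_def)
  have nb: "\<not> is_break \<theta> E z" if "x \<le> z" "z < y" for z
    using not_less_Least[of z "\<lambda>y. x \<le> y \<and> is_break \<theta> E y"] that by (auto simp: y_def)
  have fy: "(y, 0) \<in> fire \<theta> E k" using fire_first_burning_run[OF assms y(1)] nb by blast
  have "enat y \<le> fire_reach \<theta> E k" unfolding fire_reach_def using fy by (auto intro: SUP_upper2)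
  moreover have "\<not> enat y < fire_reach \<theta> E k"
    using fire_stops_at_break[OF fy y(2)] by (simp add: less_fire_reach_iff)
  ultimately show ?thesis using y nb by auto
next
  case False
  have "enat m < fire_reach \<theta> E k" for m
  proof -
    have "(max x (Suc m), 0) \<in> fire \<theta> E k"
      using fire_first_burning_run[OF assms, of "max x (Suc m)"] False by auto
    then show ?thesis using fire_downward[of "max x (Suc m)" 0 k "Suc m"] by (simp add: less_fire_reach_iff)
  qed
  then have "fire_reach \<theta> E k = \<infinity>" by (cases "fire_reach \<theta> E k") auto
  then show ?thesis ..
qed

text \<open>The fire that first passes break \<open>m\<close> contains the first burning of
  \<open>Suc m\<close>, so it runs on to the next break.\<close>

lemma succ_max_eq_nth_break:
  "succ_max \<theta> E (Suc n) = \<infinity> \<or> (\<exists>y. nth_break \<theta> E n y \<and> succ_max \<theta> E (Suc n) = enat y)"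
proof (induction n)
  case 0
  show ?case using fire_reach_eq_break[OF fire.source[of 0]] by (auto simp: nth_break_def)
next
  case (Suc n)
  show ?case
  proof (cases "succ_max \<theta> E (Suc n)")
    case (enat m)
    with Suc have m: "nth_break \<theta> E n m" by auto
    define k where "k = (LEAST k. enat m < fire_reach \<theta> E k)"
    obtain k0 where k0: "(Suc m, 0) \<in> fire \<theta> E k0" using ex_fire by blast
    then have ex: "enat m < fire_reach \<theta> E k0" by (auto simp: less_fire_reach_iff)
    then have "enat m < fire_reach \<theta> E k" unfolding k_def by (rule LeastI)
    then obtain j where j: "(Suc m, j) \<in> fire \<theta> E k" by (auto simp: less_fire_reach_iff)
    have "k \<le> k0" unfolding k_def using ex by (rule Least_le)
    \<comment> \<open>Fire \<open>k0\<close> contains burning \<open>0\<close> of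
      \<open>Suc m\<close> and so passes \<open>m\<close>; the first fire \<open>k\<close> to pass
      is no later, and fires keep their order.\<close>
    then have "j \<le> 0" using fire_index_mono[OF j k0] by simp
    with j have "(Suc m, 0) \<in> fire \<theta> E k" by simp
    moreover have "succ_max \<theta> E (Suc (Suc n)) = fire_reach \<theta> E k"
      using enat ex by (auto simp: k_def Let_def)
    ultimately show ?thesis using fire_reach_eq_break[of "Suc m" k] nth_break_Suc[OF m]
      unfolding Suc_le_eq by auto
  qed simp
qed

end

section \<open>Growth from break to break\<close>

definition run_length :: "nat \<Rightarrow> nat" where
  "run_length n = nat \<lfloor>exp (real n / 2)\<rfloor>"

text \<open>The block begins at \<open>x + 2\<close> because the first burning time of
  \<open>Suc x\<close>, which determines \<open>n\<close>, depends on the sites up to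
  \<open>Suc x\<close>.\<close>

definition run_block :: "nat \<Rightarrow> nat \<Rightarrow> nat set" where
  "run_block x n = {Suc x<..Suc x + run_length n}"

text \<open>Here \<open>n\<close> is the integer part of the first burning time of
  \<open>Suc x\<close>. A break just left of a block site \<open>z\<close> would force
  \<open>real n < E z 0\<close>. This weaker condition involves waiting times of the block only,
  which makes it independent of the past.\<close>

definition bad_block :: "nat \<Rightarrow> nat \<Rightarrow> (nat \<Rightarrow> nat \<Rightarrow> real) \<Rightarrow> bool" where
  "bad_block x n E \<longleftrightarrow>
     (\<exists>z\<in>run_block x n. real n < E z 0) \<or> (\<forall>z\<in>run_block x n. E z 1 \<le> real n / 4)"

definition break_at :: "real \<Rightarrow> nat \<Rightarrow> nat \<Rightarrow> nat \<Rightarrow> (nat \<Rightarrow> nat \<Rightarrow> real) \<Rightarrow> bool" where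
  "break_at \<theta> j x n E \<longleftrightarrow> nth_break \<theta> E j x \<and> nat \<lfloor>burn_time \<theta> E (Suc x) 0\<rfloor> = n"

definition bad_step :: "real \<Rightarrow> (nat \<Rightarrow> nat \<Rightarrow> real) \<Rightarrow> nat \<Rightarrow> bool" where
  "bad_step \<theta> E j \<longleftrightarrow>
     (\<exists>x n. break_at \<theta> j x n E \<and> bad_block x n E)"

context forest_fire
begin

text \<open>In a good block no first tree comes late enough for a break, so \<open>y\<close> lies
  beyond the block; and some \<open>z\<close> in the block has a large \<open>E z 1\<close>, which
  delays the passage of \<open>y\<close>.\<close>

lemma good_step:
  assumes good: "\<not> bad_step \<theta> E j" and x: "nth_break \<theta> E j x" and y: "nth_break \<theta> E (Suc j) y"
    and ge1: "1 \<le> real j * \<theta>"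
  shows "exp (f (Suc x) 0 / 4) \<le> real y" "9 / 8 * f (Suc x) 0 \<le> f (Suc y) 0"
proof -
  define s where "s = f (Suc x) 0"
  define n where "n = nat \<lfloor>s\<rfloor>"
  have s1: "1 \<le> s" using nth_break_time[OF x] ge1 by (simp add: s_def)
  then have "1 \<le> \<lfloor>s\<rfloor>" by simp
  then have "real n = of_int \<lfloor>s\<rfloor>" "1 \<le> (of_int \<lfloor>s\<rfloor> :: real)" by (auto simp: n_def)
  \<comment> \<open>As 1 \<le> s, rounding down loses at most half. Thus \<open>n / 2\<close> is at
    least \<open>s / 4\<close>, and \<open>n / 4\<close> at least \<open>s / 8\<close>, whence the
    factor \<open>9 / 8\<close>.\<close>
  then have n: "real n \<le> s" "s / 2 \<le> real n" by linarith+
  have nb: "\<not> bad_block x n E" using good x by (auto simp: bad_step_def break_at_def n_def s_def)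
  have xy: "x < y" using nth_break_less[OF x y] .
  have yrun: "Suc x + run_length n \<le> y"
  proof (rule ccontr)
    assume "\<not> Suc x + run_length n \<le> y"
    then have "Suc y \<in> run_block x n" using xy by (auto simp: run_block_def)
    then have "E (Suc y) 0 \<le> real n" using nb by (auto simp: bad_block_def)
    moreover have "s \<le> f y 0" using burn_time_mono[of "Suc x" y 0] xy by (simp add: s_def)
    ultimately show False using y n burning_pos by (auto simp: nth_break_def is_break_def)
  qed
  have "exp (s / 4) \<le> exp (real n / 2)" using n by simp
  also have "\<dots> \<le> real (Suc (run_length n))" unfolding run_length_def by linarith
  also have "\<dots> \<le> real y" using yrun by simp
  finally show "exp (f (Suc x) 0 / 4) \<le> real y" by (simp add: s_def)
  obtain z where z: "z \<in> run_block x n" "real n / 4 < E z 1"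
    using nb by (auto simp: bad_block_def not_le)
  then have "s \<le> f z 0" using burn_time_mono[of "Suc x" z 0] by (simp add: s_def run_block_def)
  moreover have "f z 0 + \<theta> + E z 1 \<le> f (Suc y) 0"
    using y z(1) yrun by (intro burn_time_after_break) (auto simp: nth_break_def run_block_def)
  ultimately show "9 / 8 * f (Suc x) 0 \<le> f (Suc y) 0"
    using n z(2) burning_pos unfolding s_def[symmetric] by argo
qed

lemma nth_break_pred:
  assumes "nth_break \<theta> E (Suc j) y"
  obtains x where "nth_break \<theta> E j x"
proof -
  let ?B = "{b. b < y \<and> is_break \<theta> E b}"
  have ne: "?B \<noteq> {}"
  proof
    assume "?B = {}"
    with assms show False unfolding nth_break_def by (metis card.empty Zero_not_Suc)
  qed
  define x where "x = Max ?B"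
  have x: "x \<in> ?B" unfolding x_def by (rule Max_in) (use ne in auto)
  have ub: "b \<le> x" if "b \<in> ?B" for b unfolding x_def using that by (intro Max_ge) auto
  have "?B = insert x {b. b < x \<and> is_break \<theta> E b}"
    using x ub by (auto simp: le_less)
  then have "nth_break \<theta> E j x" using assms x by (auto simp: nth_break_def)
  then show ?thesis by (rule that)
qed

lemma nth_break_time_growth:
  assumes good: "\<And>j. J \<le> j \<Longrightarrow> \<not> bad_step \<theta> E j" and ge1: "1 \<le> real J * \<theta>"
    and "nth_break \<theta> E (J + d) x"
  shows "(9 / 8) ^ d \<le> f (Suc x) 0"
  using assms(3)
proof (induction d arbitrary: x)
  case 0
  then show ?case using nth_break_time[of J x] ge1 by simp
next
  case (Suc d)
  then obtain x' where x': "nth_break \<theta> E (J + d) x'" using nth_break_pred[of "J + d" x] by auto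
  have "1 \<le> real (J + d) * \<theta>"
    using ge1 burning_pos by (simp add: algebra_simps add_increasing2)
  then have "9 / 8 * f (Suc x') 0 \<le> f (Suc x) 0"
    using good_step(2)[of "J + d"] good x' Suc.prems by simp
  with Suc.IH[OF x'] show ?case by simp
qed

lemma succ_max_growth:
  assumes "\<forall>\<^sub>F j in sequentially. \<not> bad_step \<theta> E j"
  shows "\<forall>\<^sub>F i in sequentially.
    ereal (exp (exp (ln (9 / 8) / 2 * real i))) \<le> ereal_of_enat (succ_max \<theta> E i)"
proof -
  obtain J0 where J0: "\<And>j. J0 \<le> j \<Longrightarrow> \<not> bad_step \<theta> E j"
    using assms by (auto simp: eventually_sequentially)
  obtain k where k: "1 < real k * \<theta>" using burning_pos reals_Archimedean3 by blast
  define J where "J = max J0 k"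
  have "real k * \<theta> \<le> real J * \<theta>" using burning_pos by (simp add: J_def)
  with k have ge1: "1 \<le> real J * \<theta>" by linarith
  have good: "\<not> bad_step \<theta> E j" if "J \<le> j" for j using J0 that by (simp add: J_def)
  \<comment> \<open>Growth by \<open>9 / 8\<close> per break counts only from break \<open>J\<close>
    on; halving the rate absorbs the shift by \<open>J + 2\<close> and the divisor
    \<open>4\<close>.\<close>
  have "\<forall>\<^sub>F i in sequentially. exp (ln (9 / 8) / 2 * real i) \<le> exp (ln (9 / 8) * (real i - real J - 2)) / 4"
    by real_asymp
  then have "\<forall>\<^sub>F i in sequentially. exp (ln (9 / 8) / 2 * real i) \<le> exp (ln (9 / 8) * (real i - real J - 2)) / 4 \<and> J + 2 \<le> i"
    by (intro eventually_conj eventually_ge_at_top)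
  then show ?thesis
  proof (rule eventually_mono, elim conjE)
    fix i :: nat
    assume le: "exp (ln (9 / 8) / 2 * real i) \<le> exp (ln (9 / 8) * (real i - real J - 2)) / 4"
      and "J + 2 \<le> i"
    \<comment> \<open>A finite maximum \<open>i\<close> is break \<open>J + d + 1\<close>, and its
      bound comes from the time at break \<open>J + d\<close>.\<close>
    then obtain d where d: "i = Suc (Suc (J + d))"
      by (metis add_2_eq_Suc' le_iff_add add.assoc add.commute)
    show "ereal (exp (exp (ln (9 / 8) / 2 * real i))) \<le> ereal_of_enat (succ_max \<theta> E i)"
    proof (cases "succ_max \<theta> E i = \<infinity>")
      case False
      then obtain y where y: "nth_break \<theta> E (Suc (J + d)) y" "succ_max \<theta> E i = enat y"
        using succ_max_eq_nth_break[of "Suc (J + d)"] d by auto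
      obtain x where x: "nth_break \<theta> E (J + d) x" using nth_break_pred[OF y(1)] .
      have "1 \<le> real (J + d) * \<theta>"
        using ge1 burning_pos by (simp add: algebra_simps add_increasing2)
      then have "exp (f (Suc x) 0 / 4) \<le> real y"
        using good_step(1)[OF _ x y(1)] good by simp
      moreover have "exp (ln (9 / 8) * (real i - real J - 2)) = (9 / 8 :: real) ^ d"
        using d by (simp add: exp_of_nat2_mult)
      then have "exp (ln (9 / 8) / 2 * real i) \<le> f (Suc x) 0 / 4"
        using le nth_break_time_growth[OF good ge1 x] by simp
      ultimately have "exp (exp (ln (9 / 8) / 2 * real i)) \<le> real y"
        by (meson exp_le_cancel_iff order_trans)
      then show ?thesis using y(2) by simp
    qed simp
  qed
qed

end


section \<open>Locality and measurability\<close>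

lemma burn_time_cong:
  assumes "\<And>z i. z \<le> x \<Longrightarrow> E z i = E' z i"
  shows "burn_time \<theta> E x = burn_time \<theta> E' x"
  using assms
proof (induction x)
  case 0
  then have "E 0 = E' 0" by auto
  then show ?case by simp
next
  case (Suc x)
  then have "E (Suc x) = E' (Suc x)" "burn_time \<theta> E x = burn_time \<theta> E' x" by auto
  then show ?case by simp
qed

lemma is_break_cong:
  assumes "\<And>z i. z \<le> Suc y \<Longrightarrow> E z i = E' z i"
  shows "is_break \<theta> E y = is_break \<theta> E' y"
  using burn_time_cong[of y E E'] assms by (simp add: is_break_def)

lemma nth_break_cong:
  assumes "\<And>z i. z \<le> Suc y \<Longrightarrow> E z i = E' z i"
  shows "nth_break \<theta> E j y = nth_break \<theta> E' j y"
proof -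
  have "is_break \<theta> E b = is_break \<theta> E' b" if "b \<le> y" for b
    using assms that by (intro is_break_cong) auto
  then show ?thesis unfolding nth_break_def by (intro conj_cong arg_cong2[of _ _ _ _ "(=)"] arg_cong[of _ _ card]) auto
qed

lemma measurable_ignition_time:
  assumes [measurable]: "\<And>i. g i \<in> borel_measurable N" "T \<in> borel_measurable N"
  shows "(\<lambda>\<omega>. ignition_time \<theta> (\<lambda>i. g i \<omega>) (T \<omega>)) \<in> borel_measurable N"
proof -
  \<comment> \<open>The random index takes countably many values.\<close>
  have [measurable]: "(\<lambda>\<omega>. g (LEAST i. T \<omega> \<le> g i \<omega>) \<omega>) \<in> borel_measurable N"
    by (rule measurable_compose_countable[where f = g]) measurable
  show ?thesis unfolding ignition_time_def by measurable
qed

text \<open>The measure space is arbitrary and only the coordinates up to \<open>x\<close> are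
  assumed measurable, so that the result applies to \<open>M\<close> as well as to a product over
  the sites on the left.\<close>

lemma measurable_burn_time:
  assumes "\<And>z i. z \<le> x \<Longrightarrow> F z i \<in> borel_measurable N"
  shows "(\<lambda>\<omega>. burn_time \<theta> (\<lambda>z i. F z i \<omega>) x k) \<in> borel_measurable N"
  using assms
proof (induction x arbitrary: k)
  case 0
  then have [measurable]: "F 0 i \<in> borel_measurable N" for i by simp
  show ?case by (induction k) simp_all
next
  case (Suc x)
  then have [measurable]: "F (Suc x) i \<in> borel_measurable N" for i by simp
  have [measurable]: "(\<lambda>\<omega>. burn_time \<theta> (\<lambda>z i. F z i \<omega>) x i) \<in> borel_measurable N" for i
    using Suc by simp
  show ?case
  proof (induction k)
    case 0
    show ?case by (simp add: measurable_ignition_time)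
  next
    case (Suc k)
    then show ?case by (simp add: measurable_ignition_time)
  qed
qed

lemma measurable_is_break:
  assumes "\<And>z i. z \<le> Suc y \<Longrightarrow> F z i \<in> borel_measurable N"
  shows "Measurable.pred N (\<lambda>\<omega>. is_break \<theta> (\<lambda>z i. F z i \<omega>) y)"
proof -
  have [measurable]: "F (Suc y) 0 \<in> borel_measurable N" using assms by simp
  have [measurable]: "(\<lambda>\<omega>. burn_time \<theta> (\<lambda>z i. F z i \<omega>) y 0) \<in> borel_measurable N"
    using assms by (intro measurable_burn_time) simp
  show ?thesis unfolding is_break_def by measurable
qed

lemma measurable_nth_break:
  assumes "\<And>z i. z \<le> Suc y \<Longrightarrow> F z i \<in> borel_measurable N"
  shows "Measurable.pred N (\<lambda>\<omega>. nth_break \<theta> (\<lambda>z i. F z i \<omega>) j y)"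
proof -
  have [measurable]: "Measurable.pred N (\<lambda>\<omega>. is_break \<theta> (\<lambda>z i. F z i \<omega>) b)" if "b \<le> y" for b
    using assms that by (intro measurable_is_break) simp
  have [measurable]: "Measurable.pred N (\<lambda>\<omega>. b < y \<and> is_break \<theta> (\<lambda>z i. F z i \<omega>) b)" for b
    by (cases "b < y") simp_all
  show ?thesis unfolding nth_break_def by measurable
qed

lemma measurable_bad_block:
  assumes "\<And>z i. z \<in> run_block x n \<Longrightarrow> F z i \<in> borel_measurable N"
  shows "Measurable.pred N (\<lambda>\<omega>. bad_block x n (\<lambda>z i. F z i \<omega>))"
proof -
  have [measurable]: "F z i \<in> borel_measurable N" if "z \<in> run_block x n" for z i
    using assms that by simp
  have [measurable]: "countable (run_block x n)" by (simp add: run_block_def)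
  show ?thesis unfolding bad_block_def by measurable
qed

lemma measurable_break_at:
  assumes "\<And>z i. z \<le> Suc x \<Longrightarrow> F z i \<in> borel_measurable N"
  shows "Measurable.pred N (\<lambda>\<omega>. break_at \<theta> j x n (\<lambda>z i. F z i \<omega>))"
proof -
  have [measurable]: "Measurable.pred N (\<lambda>\<omega>. nth_break \<theta> (\<lambda>z i. F z i \<omega>) j x)"
    using assms by (intro measurable_nth_break) simp
  have [measurable]: "(\<lambda>\<omega>. burn_time \<theta> (\<lambda>z i. F z i \<omega>) (Suc x) 0) \<in> borel_measurable N"
    using assms by (intro measurable_burn_time) simp
  show ?thesis unfolding break_at_def by measurable
qed

text \<open>Total probability: each \<open>B i\<close> has conditional probability at most
  \<open>q\<close> given \<open>C i\<close>, and the disjoint \<open>C i\<close> have total mass at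
  most \<open>1\<close>.\<close>

lemma (in prob_space) prob_UN_Int_le:
  fixes C B :: "nat \<Rightarrow> 'a set"
  assumes disj: "disjoint_family C" and ev: "\<And>i. C i \<in> events" "\<And>i. B i \<in> events"
    and le: "\<And>i. prob (C i \<inter> B i) \<le> q * prob (C i)" and "0 \<le> q"
  shows "prob (\<Union>i. C i \<inter> B i) \<le> q"
proof -
  have sums: "(\<lambda>i. prob (C i)) sums prob (\<Union>i. C i)"
    using disj ev by (intro finite_measure_UNION) auto
  then have s1: "summable (\<lambda>i. q * prob (C i))"
    by (intro summable_mult) (rule sums_summable)
  have s2: "summable (\<lambda>i. prob (C i \<inter> B i))"
    by (rule summable_comparison_test'[OF s1, of 0]) (use le in simp)
  have "prob (\<Union>i. C i \<inter> B i) \<le> (\<Sum>i. prob (C i \<inter> B i))"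
    using ev s2 by (intro finite_measure_subadditive_countably) auto
  also have "\<dots> \<le> (\<Sum>i. q * prob (C i))"
    by (rule suminf_le[OF le s2 s1])
  also have "\<dots> = q * prob (\<Union>i. C i)"
    using sums by (simp add: suminf_mult sums_summable sums_unique[symmetric])
  also have "\<dots> \<le> q * 1" using \<open>0 \<le> q\<close> by (intro mult_left_mono) auto
  finally show ?thesis by simp
qed

section \<open>The random model and Borel-Cantelli\<close>

locale random_forest_fire = prob_space M for M :: "'a measure" +
  fixes E :: "nat \<Rightarrow> nat \<Rightarrow> 'a \<Rightarrow> real" and \<theta> :: real
  assumes indep: "indep_vars (\<lambda>_. borel) (\<lambda>(x, i). E x i) (UNIV :: (nat \<times> nat) set)"
    and expo: "\<And>x i. distributed M lborel (E x i) (exponential_density 1)"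
    and theta_pos: "0 < \<theta>"
begin

abbreviation W :: "'a \<Rightarrow> nat \<Rightarrow> nat \<Rightarrow> real" where "W \<omega> \<equiv> \<lambda>x i. E x i \<omega>"

lemma measurable_waiting [measurable]: "E x i \<in> borel_measurable M"
  using distributed_measurable[OF expo[of x i]] by simp

lemma AE_forest_fire: "AE \<omega> in M. forest_fire \<theta> (W \<omega>)"
proof -
  have "AE \<omega> in M. 0 < E x i \<omega>" for x i
  proof -
    have "prob {\<omega> \<in> space M. 0 < E x i \<omega>} = 1"
      using exponential_distributedD_gt[OF expo[of x i], of 0] by simp
    then show ?thesis by (subst (asm) prob_Collect_eq_1) auto
  qed
  then have "AE \<omega> in M. \<forall>x i. 0 < E x i \<omega>" by (simp add: AE_all_countable)
  then show ?thesis by eventually_elim (auto simp: forest_fire_def theta_pos)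
qed

lemma prob_all_waiting_le:
  assumes "finite Z" "0 \<le> a"
  shows "prob {\<omega> \<in> space M. \<forall>z\<in>Z. E z i \<omega> \<le> a} = (1 - exp (- a)) ^ card Z"
\<comment> \<open>An intersection over the empty index set would be \<open>UNIV\<close> instead of
  \<open>space M\<close>.\<close>
proof (cases "Z = {}")
  case True
  then show ?thesis by (simp add: prob_space)
next
  case False
  let ?A = "\<lambda>p. (case p of (x, i) \<Rightarrow> E x i) -` {..a} \<inter> space M"
  have A: "prob (?A (z, i)) = 1 - exp (- a)" for z
  proof -
    have "?A (z, i) = {\<omega> \<in> space M. E z i \<omega> \<le> a}" by auto
    then show ?thesis using exponential_distributedD_le[OF expo assms(2), of z i] by simp
  qed
  have "{\<omega> \<in> space M. \<forall>z\<in>Z. E z i \<omega> \<le> a} = (\<Inter>p\<in>Z \<times> {i}. ?A p)"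
    using False by auto
  then have "prob {\<omega> \<in> space M. \<forall>z\<in>Z. E z i \<omega> \<le> a} = prob (\<Inter>p\<in>Z \<times> {i}. ?A p)"
    by (rule arg_cong)
  also have "\<dots> = (\<Prod>p\<in>Z \<times> {i}. prob (?A p))"
    using False assms(1) by (intro indep_varsD[OF indep]) auto
  also have "\<dots> = (\<Prod>p\<in>Z \<times> {i}. 1 - exp (- a))"
    using A by (intro prod.cong refl) (metis mem_Sigma_iff singletonD surj_pair)
  also have "\<dots> = (1 - exp (- a)) ^ card Z" by (simp add: card_cartesian_product)
  finally show ?thesis .
qed

text \<open>With \<open>u = exp (n / 4)\<close> the block has about \<open>u ^ 2\<close> sites. A
  union bound gives \<open>u ^ 2 / u ^ 4\<close> for a late first tree; independence gives
  \<open>(1 - 1 / u) ^ run_length n\<close>, at most \<open>exp (1 - u)\<close>, for small second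
  waiting times. Both are at most \<open>1 / u\<close>.\<close>

lemma prob_bad_block: "prob {\<omega> \<in> space M. bad_block x n (W \<omega>)} \<le> 2 * exp (- real n / 4)"
proof -
  let ?Z = "run_block x n"
  define u where "u = exp (real n / 4)"
  have u1: "1 \<le> u" by (simp add: u_def)
  have u2: "exp (real n / 2) = u ^ 2" using exp_of_nat_mult[of 2 "real n / 4"] by (simp add: u_def)
  have card: "card ?Z = run_length n" and fin: "finite ?Z" by (auto simp: run_block_def)
  have len: "real (run_length n) \<le> u ^ 2" "u ^ 2 - 1 \<le> real (run_length n)"
    using u1 by (simp_all add: run_length_def u2)
  have iu: "exp (- real n / 4) = 1 / u" by (simp add: u_def exp_minus inverse_eq_divide)
  have "prob {\<omega> \<in> space M. \<exists>z\<in>?Z. real n < E z 0 \<omega>} = prob (\<Union>z\<in>?Z. {\<omega> \<in> space M. real n < E z 0 \<omega>})"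
    by (intro arg_cong[of _ _ prob]) auto
  also have "\<dots> \<le> (\<Sum>z\<in>?Z. prob {\<omega> \<in> space M. real n < E z 0 \<omega>})"
    using fin by (intro finite_measure_subadditive_finite) auto
  also have "\<dots> = (\<Sum>z\<in>?Z. exp (- real n))"
    using exponential_distributedD_gt[OF expo, of "real n"] by simp
  also have "\<dots> = real (run_length n) * exp (- real n)" by (simp add: card)
  also have "exp (- real n) = 1 / u ^ 4"
    using exp_of_nat_mult[of 4 "real n / 4"] by (simp add: u_def exp_minus inverse_eq_divide)
  also have "real (run_length n) * (1 / u ^ 4) \<le> u ^ 2 * (1 / u ^ 4)"
    using len by (intro mult_right_mono) auto
  also have "\<dots> = 1 / u ^ 2"
    using u1 by (simp add: power4_eq_xxxx power2_eq_square)
  also have "\<dots> \<le> 1 / u"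
    using u1 by (intro divide_left_mono) (auto simp: power2_eq_square)
  finally have p1: "prob {\<omega> \<in> space M. \<exists>z\<in>?Z. real n < E z 0 \<omega>} \<le> 1 / u" .
  have "prob {\<omega> \<in> space M. \<forall>z\<in>?Z. E z 1 \<omega> \<le> real n / 4} = (1 - 1 / u) ^ run_length n"
    using prob_all_waiting_le[OF fin, of "real n / 4" 1] iu card by simp
  also have "\<dots> \<le> exp (- (1 / u)) ^ run_length n"
    using u1 exp_ge_add_one_self[of "- (1 / u)"] by (intro power_mono) auto
  also have "\<dots> = exp (- (real (run_length n) / u))" using exp_of_nat_mult[of "run_length n" "- (1 / u)"] by simp
  also have "\<dots> \<le> exp (1 - u)"
  proof -
    have "(u - 1) * u \<le> u ^ 2 - 1" using u1 by (simp add: power2_eq_square algebra_simps)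
    then have "(u - 1) * u \<le> real (run_length n)" using len by simp
    then have "u - 1 \<le> real (run_length n) / u" using u1 by (subst pos_le_divide_eq) auto
    then show ?thesis by simp
  qed
  also have "\<dots> \<le> 1 / u"
  proof -
    have "u \<le> exp (u - 1)" using exp_ge_add_one_self[of "u - 1"] by simp
    then have "1 / exp (u - 1) \<le> 1 / u" using u1 by (intro divide_left_mono) auto
    then show ?thesis using exp_minus[of "u - 1"] by (simp add: inverse_eq_divide)
  qed
  finally have p2: "prob {\<omega> \<in> space M. \<forall>z\<in>?Z. E z 1 \<omega> \<le> real n / 4} \<le> 1 / u" .
  have [measurable]: "countable ?Z" using fin by (rule countable_finite)
  have "{\<omega> \<in> space M. bad_block x n (W \<omega>)}
      = {\<omega> \<in> space M. \<exists>z\<in>?Z. real n < E z 0 \<omega>} \<union> {\<omega> \<in> space M. \<forall>z\<in>?Z. E z 1 \<omega> \<le> real n / 4}"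
    by (auto simp: bad_block_def)
  then have "prob {\<omega> \<in> space M. bad_block x n (W \<omega>)} \<le>
      prob {\<omega> \<in> space M. \<exists>z\<in>?Z. real n < E z 0 \<omega>} + prob {\<omega> \<in> space M. \<forall>z\<in>?Z. E z 1 \<omega> \<le> real n / 4}"
    by (simp add: measure_Un_le)
  with p1 p2 iu show ?thesis by linarith
qed

text \<open>The first event depends on the sites up to \<open>Suc x\<close>, the second on sites
  beyond; both are pulled back from the independent restrictions \<open>V L\<close> and
  \<open>V R\<close>.\<close>

lemma prob_break_at_Int_bad_block:
  "prob ({\<omega> \<in> space M. break_at \<theta> j x n (W \<omega>)} \<inter> {\<omega> \<in> space M. bad_block x n (W \<omega>)}) =
   prob {\<omega> \<in> space M. break_at \<theta> j x n (W \<omega>)} * prob {\<omega> \<in> space M. bad_block x n (W \<omega>)}"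
proof -
  define L R :: "(nat \<times> nat) set" where "L = {..Suc x} \<times> UNIV" and "R = {Suc x<..} \<times> UNIV"
  define V where "V = (\<lambda>(A :: (nat \<times> nat) set) \<omega>. \<lambda>p\<in>A. (case p of (x, i) \<Rightarrow> E x i) \<omega>)"
  let ?P = "\<lambda>A. PiM A (\<lambda>_. borel :: real measure)"
  have ind: "indep_var (?P L) (V L) (?P R) (V R)"
    unfolding V_def by (rule indep_var_restrict[OF indep]) (auto simp: L_def R_def)
  have V: "V A \<omega> \<in> space (?P A)" for A \<omega> by (auto simp: V_def space_PiM)
  have comp: "(\<lambda>e. e (z, i)) \<in> borel_measurable (?P A)" if "(z, i) \<in> A" for A z i
    using that by (rule measurable_component_singleton)
  define C where "C = {e \<in> space (?P L). break_at \<theta> j x n (\<lambda>z i. e (z, i))}"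
  define B where "B = {e \<in> space (?P R). bad_block x n (\<lambda>z i. e (z, i))}"
  have sets: "C \<in> sets (?P L)" "B \<in> sets (?P R)"
    unfolding C_def B_def
    by (rule predE, rule measurable_break_at, rule comp, simp add: L_def)
       (rule predE, rule measurable_bad_block, rule comp, simp add: R_def run_block_def)
  \<comment> \<open>Outside \<open>L\<close> the restriction is \<open>undefined\<close>, but by
    locality \<open>break_at\<close> does not see these coordinates.\<close>
  have "break_at \<theta> j x n (\<lambda>z i. V L \<omega> (z, i)) = break_at \<theta> j x n (W \<omega>)" for \<omega>
    using nth_break_cong[of x "\<lambda>z i. V L \<omega> (z, i)" "W \<omega>"]
      burn_time_cong[of "Suc x" "\<lambda>z i. V L \<omega> (z, i)" "W \<omega>"]
    unfolding break_at_def by (simp add: V_def L_def)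
  then have C: "V L \<omega> \<in> C \<longleftrightarrow> break_at \<theta> j x n (W \<omega>)" for \<omega> using V by (simp add: C_def)
  have "bad_block x n (\<lambda>z i. V R \<omega> (z, i)) = bad_block x n (W \<omega>)" for \<omega>
    unfolding bad_block_def by (simp add: V_def R_def run_block_def)
  then have B: "V R \<omega> \<in> B \<longleftrightarrow> bad_block x n (W \<omega>)" for \<omega> using V by (simp add: B_def)
  have "prob ((\<lambda>\<omega>. (V L \<omega>, V R \<omega>)) -` (C \<times> B) \<inter> space M) =
      prob (V L -` C \<inter> space M) * prob (V R -` B \<inter> space M)"
    by (rule indep_varD[OF ind sets])
  moreover have "(\<lambda>\<omega>. (V L \<omega>, V R \<omega>)) -` (C \<times> B) \<inter> space M =
      {\<omega> \<in> space M. break_at \<theta> j x n (W \<omega>)} \<inter> {\<omega> \<in> space M. bad_block x n (W \<omega>)}"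
    using C B by auto
  moreover have "V L -` C \<inter> space M = {\<omega> \<in> space M. break_at \<theta> j x n (W \<omega>)}"
    "V R -` B \<inter> space M = {\<omega> \<in> space M. bad_block x n (W \<omega>)}"
    using C B by auto
  ultimately show ?thesis by simp
qed

lemma AE_eventually_not_bad_step:
  "AE \<omega> in M. \<forall>\<^sub>F j in sequentially. \<not> bad_step \<theta> (W \<omega>) j"
proof -
  \<comment> \<open>The lower bound on \<open>n\<close> holds automatically at break
    \<open>j\<close> when all waiting times are positive. Built into \<open>C\<close>, it makes
    \<open>q j\<close> a bound for every pair: where it fails, \<open>C j p\<close> is
    empty.\<close>
  define C where "C j p = (case prod_decode p of (x, n) \<Rightarrow>
    {\<omega> \<in> space M. break_at \<theta> j x n (W \<omega>) \<and> real j * \<theta> - 1 \<le> real n})" for j p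
  define B where "B p = (case prod_decode p of (x, n) \<Rightarrow> {\<omega> \<in> space M. bad_block x n (W \<omega>)})" for p
  define A where "A j = (\<Union>p. C j p \<inter> B p)" for j
  define q where "q j = 2 * exp ((1 - real j * \<theta>) / 4)" for j
  have [measurable]: "Measurable.pred M (\<lambda>\<omega>. break_at \<theta> j x n (W \<omega>))"
    "Measurable.pred M (\<lambda>\<omega>. bad_block x n (W \<omega>))" for j x n
    by (auto intro: measurable_break_at measurable_bad_block)
  have ev: "C j p \<in> events" "B p \<in> events" for j p
    by (auto simp: C_def B_def split: prod.split)
  then have A: "A j \<in> events" for j by (auto simp: A_def)
  have "prob (A j) \<le> q j" for j
    unfolding A_def
  proof (rule prob_UN_Int_le)
    show "disjoint_family (C j)"
      unfolding disjoint_family_on_def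
    proof (intro ballI impI equals0I)
      fix p p' \<omega> assume "p \<noteq> p'" and \<omega>: "\<omega> \<in> C j p \<inter> C j p'"
      obtain x n x' n' where d: "prod_decode p = (x, n)" "prod_decode p' = (x', n')"
        by (metis surj_pair)
      then have "nth_break \<theta> (W \<omega>) j x" "nth_break \<theta> (W \<omega>) j x'"
        using \<omega> by (auto simp: C_def break_at_def)
      then have "x = x'" by (rule nth_break_inj)
      with \<omega> d have "prod_decode p = prod_decode p'" by (auto simp: C_def break_at_def)
      with \<open>p \<noteq> p'\<close> show False by (simp add: prod_decode_eq)
    qed
    show "C j p \<in> events" "B p \<in> events" for p by (rule ev)+
    show "0 \<le> q j" by (simp add: q_def)
    show "prob (C j p \<inter> B p) \<le> q j * prob (C j p)" for p
    proof -
      obtain x n where d: "prod_decode p = (x, n)" by (metis surj_pair)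
      show ?thesis
      proof (cases "real j * \<theta> - 1 \<le> real n")
        case True
        then have "prob (C j p \<inter> B p) = prob (C j p) * prob (B p)"
          using prob_break_at_Int_bad_block[of j x n] by (simp add: C_def B_def d)
        also have "\<dots> \<le> prob (C j p) * q j"
        proof (rule mult_left_mono)
          have "prob (B p) \<le> 2 * exp (- real n / 4)"
            using prob_bad_block[of x n] by (simp add: B_def d)
          also have "\<dots> \<le> q j" using True by (simp add: q_def)
          finally show "prob (B p) \<le> q j" .
        qed simp
        finally show ?thesis by (simp add: mult.commute)
      qed (simp add: C_def d)
    qed
  qed
  moreover have "summable q"
  proof -
    have q: "q j = 2 * exp (1 / 4) * exp (- \<theta> / 4) ^ j" for j
    proof -
      have "(1 - real j * \<theta>) / 4 = 1 / 4 + real j * (- \<theta> / 4)" by (simp add: diff_divide_distrib)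
      then show ?thesis unfolding q_def by (simp only: exp_add exp_of_nat_mult mult.assoc)
    qed
    have "summable (\<lambda>j. 2 * exp (1 / 4) * exp (- \<theta> / 4) ^ j)"
      using theta_pos by (intro summable_mult summable_geometric) simp
    then show ?thesis by (simp only: q[abs_def])
  qed
  ultimately have "summable (\<lambda>j. prob (A j))"
    by (simp add: summable_comparison_test'[of q 0])
  then have "AE \<omega> in M. \<forall>\<^sub>F j in sequentially. \<omega> \<in> space M - A j"
    using A by (intro borel_cantelli_AE1) (auto simp: emeasure_eq_measure)
  with AE_forest_fire show ?thesis
  proof eventually_elim
    case (elim \<omega>)
    interpret forest_fire \<theta> "W \<omega>" by (rule elim)
    show ?case using elim(2)
    proof (rule eventually_mono)
      fix j assume j: "\<omega> \<in> space M - A j"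
      show "\<not> bad_step \<theta> (W \<omega>) j"
      proof
        assume "bad_step \<theta> (W \<omega>) j"
        then obtain x n where b: "break_at \<theta> j x n (W \<omega>)" "bad_block x n (W \<omega>)"
          by (auto simp: bad_step_def)
        \<comment> \<open>The first burning time of \<open>Suc x\<close> is at least
          \<open>j * \<theta>\<close>, and its integer part is smaller by less than
          \<open>1\<close>.\<close>
        then have "real j * \<theta> - 1 \<le> real n"
          using nth_break_time[of j x] by (simp add: break_at_def) linarith
        with b j have "\<omega> \<in> C j (prod_encode (x, n)) \<inter> B (prod_encode (x, n))"
          by (simp add: C_def B_def)
        with j show False by (auto simp: A_def)
      qed
    qed
  qed
qed

end

theorem theorem4p7:
  fixes M :: "'a measure"
    and E :: "nat \<Rightarrow> nat \<Rightarrow> 'a \<Rightarrow> real"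
    and \<theta> :: real
  assumes "prob_space M"
    and "prob_space.indep_vars M (\<lambda>_. borel) (\<lambda>(x, i). E x i) (UNIV :: (nat \<times> nat) set)"
    and "\<And>x i. distributed M lborel (E x i) (exponential_density 1)"
    and "\<theta> > 0"
  shows "\<exists>\<alpha>>0. AE \<omega> in M. \<forall>\<^sub>F i in sequentially.
           ereal_of_enat (succ_max \<theta> (\<lambda>x j. E x j \<omega>) i) \<ge> ereal (exp (exp (\<alpha> * real i)))"
proof (intro exI conjI)
  interpret random_forest_fire M E \<theta>
    using assms by (intro random_forest_fire.intro random_forest_fire_axioms.intro) auto
  show "0 < ln (9 / 8 :: real) / 2" by simp
  show "AE \<omega> in M. \<forall>\<^sub>F i in sequentially.
      ereal (exp (exp (ln (9 / 8) / 2 * real i))) \<le> ereal_of_enat (succ_max \<theta> (\<lambda>x j. E x j \<omega>) i)"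
    using AE_forest_fire AE_eventually_not_bad_step
    by eventually_elim (rule forest_fire.succ_max_growth)
qed

end
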